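(* Let $K$ be a loopfree category and let $G$ be a group acting horizontally on $K$. Then the quotient $K/G$ is again a loopfree category. In particular, the quotient of a poset by a horizontal action is a loopfree category.
   Context: $\mathcal M_K(x,y)$ denotes the set of morphisms from $x$ to $y$ in a small category $K$. $K$ is loopfree if for all objects $x\ne y$ at most one of $\mathcal M_K(x,y)$, $\mathcal M_K(y,x)$ is nonempty, and $\mathcal M_K(x,x)=\{\mathrm{id}_x\}$ for all $x$. A poset is regarded as a category with exactly one morphism from $x$ to $y$ when $x\ge y$ and none otherwise. A group $G$ (viewed as a one-object category) acts on $K$ if there is a functor $\mathcal A_K:G\to\mathbf{Cat}$ ($\mathbf{Cat}$ = category of small categories) sending the unique object to $K$; thus each $g\in G$ acts as an automorphism of $K$. The quotient $K/G$ is the colimit of $\mathcal A_K$ in $\mathbf{Cat}$ (even when $K$ is a poset). A functor $T:K\to K$ is horizontal if for every object $x$ with $T(x)\ne x$ one has $\mathcal M_K(x,T(x))=\mathcal M_K(T(x),x)=\emptyset$; the action is horizontal if every $g\in G$ is a horizontal functor. *)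

theory Defs
  imports "HOL-Algebra.Group"
begin

section \<open>Small categories and functors\<close>

record ('o, 'm) cat =
  Obj :: "'o set"
  Mor :: "'m set"
  Dom :: "'m \<Rightarrow> 'o"
  Cod :: "'m \<Rightarrow> 'o"
  Ident :: "'o \<Rightarrow> 'm"
  Comp :: "'m \<Rightarrow> 'm \<Rightarrow> 'm"

text \<open>\<^term>\<open>Comp K g f\<close> is ``\<open>g\<close> after \<open>f\<close>''.  Nothing is required of the structure maps
  outside the carriers \<^term>\<open>Obj K\<close> and \<^term>\<open>Mor K\<close>.\<close>

locale category =
  fixes K :: "('o, 'm) cat"
  assumes Dom_closed: "f \<in> Mor K \<Longrightarrow> Dom K f \<in> Obj K"
    and Cod_closed: "f \<in> Mor K \<Longrightarrow> Cod K f \<in> Obj K"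
    and Ident_closed: "x \<in> Obj K \<Longrightarrow> Ident K x \<in> Mor K"
    and Dom_Ident: "x \<in> Obj K \<Longrightarrow> Dom K (Ident K x) = x"
    and Cod_Ident: "x \<in> Obj K \<Longrightarrow> Cod K (Ident K x) = x"
    and Comp_closed: "\<lbrakk>f \<in> Mor K; g \<in> Mor K; Dom K g = Cod K f\<rbrakk> \<Longrightarrow> Comp K g f \<in> Mor K"
    and Dom_Comp: "\<lbrakk>f \<in> Mor K; g \<in> Mor K; Dom K g = Cod K f\<rbrakk> \<Longrightarrow> Dom K (Comp K g f) = Dom K f"
    and Cod_Comp: "\<lbrakk>f \<in> Mor K; g \<in> Mor K; Dom K g = Cod K f\<rbrakk> \<Longrightarrow> Cod K (Comp K g f) = Cod K g"
    and Comp_Ident_right: "f \<in> Mor K \<Longrightarrow> Comp K f (Ident K (Dom K f)) = f"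
    and Comp_Ident_left: "f \<in> Mor K \<Longrightarrow> Comp K (Ident K (Cod K f)) f = f"
    and Comp_assoc: "\<lbrakk>f \<in> Mor K; g \<in> Mor K; h \<in> Mor K; Dom K g = Cod K f; Dom K h = Cod K g\<rbrakk>
      \<Longrightarrow> Comp K h (Comp K g f) = Comp K (Comp K h g) f"

definition Hom :: "('o, 'm) cat \<Rightarrow> 'o \<Rightarrow> 'o \<Rightarrow> 'm set" where
  "Hom K x y = {f \<in> Mor K. Dom K f = x \<and> Cod K f = y}"

record ('o, 'm, 'p, 'q) func =
  omap :: "'o \<Rightarrow> 'p"
  mmap :: "'m \<Rightarrow> 'q"

locale cat_functor = source: category C + target: category D
  for C :: "('o, 'm) cat" and D :: "('p, 'q) cat" +
  fixes F :: "('o, 'm, 'p, 'q) func"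
  assumes omap_closed: "x \<in> Obj C \<Longrightarrow> omap F x \<in> Obj D"
    and mmap_closed: "f \<in> Mor C \<Longrightarrow> mmap F f \<in> Mor D"
    and Dom_mmap: "f \<in> Mor C \<Longrightarrow> Dom D (mmap F f) = omap F (Dom C f)"
    and Cod_mmap: "f \<in> Mor C \<Longrightarrow> Cod D (mmap F f) = omap F (Cod C f)"
    and mmap_Ident: "x \<in> Obj C \<Longrightarrow> mmap F (Ident C x) = Ident D (omap F x)"
    and mmap_Comp: "\<lbrakk>f \<in> Mor C; g \<in> Mor C; Dom C g = Cod C f\<rbrakk>
      \<Longrightarrow> mmap F (Comp C g f) = Comp D (mmap F g) (mmap F f)"

definition func_id :: "('o, 'm, 'o, 'm) func" where
  "func_id = \<lparr>omap = (\<lambda>x. x), mmap = (\<lambda>f. f)\<rparr>"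

definition func_comp ::
  "('p, 'q, 'r, 's) func \<Rightarrow> ('o, 'm, 'p, 'q) func \<Rightarrow> ('o, 'm, 'r, 's) func" where
  "func_comp F' F = \<lparr>omap = omap F' \<circ> omap F, mmap = mmap F' \<circ> mmap F\<rparr>"

text \<open>Equality of functors with source \<open>C\<close>; values outside the carriers are irrelevant.\<close>

definition func_eq ::
  "('o, 'm) cat \<Rightarrow> ('o, 'm, 'p, 'q) func \<Rightarrow> ('o, 'm, 'p, 'q) func \<Rightarrow> bool" where
  "func_eq C F F' \<longleftrightarrow>
     (\<forall>x\<in>Obj C. omap F x = omap F' x) \<and> (\<forall>f\<in>Mor C. mmap F f = mmap F' f)"

definition loopfree :: "('o, 'm) cat \<Rightarrow> bool" where
  "loopfree K \<longleftrightarrow> category K \<and>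
     (\<forall>x\<in>Obj K. \<forall>y\<in>Obj K. x \<noteq> y \<longrightarrow> Hom K x y = {} \<or> Hom K y x = {}) \<and>
     (\<forall>x\<in>Obj K. Hom K x x = {Ident K x})"

text \<open>A partial order \<open>r\<close> on \<open>X\<close> (where \<open>(y, x) \<in> r\<close> means \<open>y \<le> x\<close>) as a category: there is
  exactly one morphism from \<open>x\<close> to \<open>y\<close> if \<open>x \<ge> y\<close>, namely the pair \<open>(x, y)\<close>.\<close>

definition poset_cat :: "'a set \<Rightarrow> 'a rel \<Rightarrow> ('a, 'a \<times> 'a) cat" where
  "poset_cat X r =
     \<lparr>Obj = X, Mor = {(x, y). x \<in> X \<and> y \<in> X \<and> (y, x) \<in> r}, Dom = fst, Cod = snd,
      Ident = (\<lambda>x. (x, x)), Comp = (\<lambda>g f. (fst f, snd g))\<rparr>"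


section \<open>Colimits in the category of small categories\<close>

text \<open>A diagram of shape \<open>J\<close>, that is, a functor from \<open>J\<close> to \<open>Cat\<close> with object part \<open>D\<close> and
  morphism part \<open>E\<close>.\<close>

definition is_diagram ::
  "('i, 'j) cat \<Rightarrow> ('i \<Rightarrow> ('o, 'm) cat) \<Rightarrow> ('j \<Rightarrow> ('o, 'm, 'o, 'm) func) \<Rightarrow> bool" where
  "is_diagram J D E \<longleftrightarrow> category J \<and>
     (\<forall>i\<in>Obj J. category (D i)) \<and>
     (\<forall>u\<in>Mor J. cat_functor (D (Dom J u)) (D (Cod J u)) (E u)) \<and>
     (\<forall>i\<in>Obj J. func_eq (D i) (E (Ident J i)) func_id) \<and>
     (\<forall>u\<in>Mor J. \<forall>v\<in>Mor J. Dom J v = Cod J u \<longrightarrow>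
        func_eq (D (Dom J u)) (E (Comp J v u)) (func_comp (E v) (E u)))"

definition is_cocone ::
  "('i, 'j) cat \<Rightarrow> ('i \<Rightarrow> ('o, 'm) cat) \<Rightarrow> ('j \<Rightarrow> ('o, 'm, 'o, 'm) func) \<Rightarrow>
   ('u, 'v) cat \<Rightarrow> ('i \<Rightarrow> ('o, 'm, 'u, 'v) func) \<Rightarrow> bool" where
  "is_cocone J D E Q P \<longleftrightarrow> category Q \<and>
     (\<forall>i\<in>Obj J. cat_functor (D i) Q (P i)) \<and>
     (\<forall>u\<in>Mor J. func_eq (D (Dom J u)) (func_comp (P (Cod J u)) (E u)) (P (Dom J u)))"

text \<open>\<^term>\<open>is_colimit TYPE('p) TYPE('q) J D E Q P\<close>: the cocone \<open>P\<close> to \<open>Q\<close> is universal among the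
  cocones to categories \<open>R\<close> with objects in \<open>'p\<close> and morphisms in \<open>'q\<close>.  A colimit in \<open>Cat\<close> is
  universal for all types \<open>'p\<close> and \<open>'q\<close>; as a formula cannot quantify over types, the types of
  the test categories are parameters.\<close>

definition is_colimit ::
  "'p itself \<Rightarrow> 'q itself \<Rightarrow>
   ('i, 'j) cat \<Rightarrow> ('i \<Rightarrow> ('o, 'm) cat) \<Rightarrow> ('j \<Rightarrow> ('o, 'm, 'o, 'm) func) \<Rightarrow>
   ('u, 'v) cat \<Rightarrow> ('i \<Rightarrow> ('o, 'm, 'u, 'v) func) \<Rightarrow> bool" where
  "is_colimit _ _ J D E Q P \<longleftrightarrow> is_cocone J D E Q P \<and>
     (\<forall>(R :: ('p, 'q) cat) S. is_cocone J D E R S \<longrightarrow>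
        (\<exists>U. cat_functor Q R U \<and> (\<forall>i\<in>Obj J. func_eq (D i) (func_comp U (P i)) (S i)) \<and>
          (\<forall>U'. cat_functor Q R U' \<and> (\<forall>i\<in>Obj J. func_eq (D i) (func_comp U' (P i)) (S i))
             \<longrightarrow> func_eq Q U' U)))"


section \<open>Group actions and quotients\<close>

definition group_cat :: "('g, 'b) monoid_scheme \<Rightarrow> (unit, 'g) cat" where
  "group_cat G =
     \<lparr>Obj = {()}, Mor = carrier G, Dom = (\<lambda>_. ()), Cod = (\<lambda>_. ()),
      Ident = (\<lambda>_. \<one>\<^bsub>G\<^esub>), Comp = (\<lambda>g h. g \<otimes>\<^bsub>G\<^esub> h)\<rparr>"

definition acts_on ::
  "('g, 'b) monoid_scheme \<Rightarrow> ('o, 'm) cat \<Rightarrow> ('g \<Rightarrow> ('o, 'm, 'o, 'm) func) \<Rightarrow> bool" where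
  "acts_on G K A \<longleftrightarrow> group G \<and> is_diagram (group_cat G) (\<lambda>_. K) A"

text \<open>The category \<open>Q\<close> with the projection \<open>P : K \<rightarrow> Q\<close> is a quotient \<open>K/G\<close>.\<close>

definition is_quotient ::
  "'p itself \<Rightarrow> 'q itself \<Rightarrow>
   ('g, 'b) monoid_scheme \<Rightarrow> ('o, 'm) cat \<Rightarrow> ('g \<Rightarrow> ('o, 'm, 'o, 'm) func) \<Rightarrow>
   ('u, 'v) cat \<Rightarrow> ('o, 'm, 'u, 'v) func \<Rightarrow> bool" where
  "is_quotient p q G K A Q P \<longleftrightarrow> is_colimit p q (group_cat G) (\<lambda>_. K) A Q (\<lambda>_. P)"

definition horizontal_functor :: "('o, 'm) cat \<Rightarrow> ('o, 'm, 'o, 'm) func \<Rightarrow> bool" where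
  "horizontal_functor K T \<longleftrightarrow> cat_functor K K T \<and>
     (\<forall>x\<in>Obj K. omap T x \<noteq> x \<longrightarrow> Hom K x (omap T x) = {} \<and> Hom K (omap T x) x = {})"

definition horizontal_action ::
  "('g, 'b) monoid_scheme \<Rightarrow> ('o, 'm) cat \<Rightarrow> ('g \<Rightarrow> ('o, 'm, 'o, 'm) func) \<Rightarrow> bool" where
  "horizontal_action G K A \<longleftrightarrow> acts_on G K A \<and> (\<forall>g\<in>carrier G. horizontal_functor K (A g))"

end

theory Submission
  imports Defs
begin

text \<open>
  For any group action on a category \<open>K\<close> the quotient \<open>K/G\<close> has a model in which no zigzags or
  formal composites are needed.  Its objects are the orbits of objects of \<open>K\<close>, and its morphisms
  are the classes of \<^emph>\<open>single\<close> morphisms of \<open>K\<close> under the smallest equivalence relation that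
  contains \<open>f \<approx> g\<cdot>f\<close> and is compatible with those composites that exist in \<open>K\<close>.  If the codomain of
  \<open>f\<close> and the domain of \<open>f'\<close> lie in the same orbit, then \<open>f'\<close> can be translated by a group element
  so that it becomes composable with \<open>f\<close>; so any two composable classes have composable
  representatives, and compatibility makes the class of the composite independent of their
  choice.  A functor on \<open>K\<close> that is invariant under the action is constant on the classes,
  which gives the universal property (\<open>is_quotient_quot_cat\<close>).

  If \<open>K\<close> is loopfree and the action is horizontal, this model is loopfree
  (\<open>loopfree_quot_cat\<close>).  An endomorphism of the orbit of \<open>x\<close> is represented by a morphism
  \<open>x \<rightarrow> h\<cdot>x\<close>, so \<open>h\<cdot>x = x\<close> by horizontality and the morphism is the identity.  Morphisms
  in both directions between the orbits of \<open>x\<close> and \<open>y\<close> lift, after translation, to \<open>x \<rightarrow> h\<cdot>y\<close> and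
  \<open>h\<cdot>y \<rightarrow> k\<cdot>x\<close>.  Their composite forces \<open>k\<cdot>x = x\<close>, and then loopfreeness of \<open>K\<close> forces \<open>h\<cdot>y = x\<close>.

  Any other quotient is a retract of this model by the universal properties, and
  loopfreeness passes to retracts (\<open>loopfree_retract\<close>).
\<close>

section \<open>Group actions on categories\<close>

locale cat_action =
  fixes G :: "('g, 'b) monoid_scheme"
    and K :: "('o, 'm) cat" and A :: "'g \<Rightarrow> ('o, 'm, 'o, 'm) func"
  assumes acts: "acts_on G K A"
begin

lemma group_G: "group G"
  using acts by (simp add: acts_on_def)

lemma category_K: "category K"
  using acts by (simp add: acts_on_def is_diagram_def group_cat_def)

lemma functor_A: "g \<in> carrier G \<Longrightarrow> cat_functor K K (A g)"
  using acts by (simp add: acts_on_def is_diagram_def group_cat_def)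

sublocale group G by (rule group_G)
sublocale category K by (rule category_K)

lemma act_closed:
  assumes "g \<in> carrier G"
  shows "x \<in> Obj K \<Longrightarrow> omap (A g) x \<in> Obj K"
    and "f \<in> Mor K \<Longrightarrow> mmap (A g) f \<in> Mor K"
    and "f \<in> Mor K \<Longrightarrow> Dom K (mmap (A g) f) = omap (A g) (Dom K f)"
    and "f \<in> Mor K \<Longrightarrow> Cod K (mmap (A g) f) = omap (A g) (Cod K f)"
    and "x \<in> Obj K \<Longrightarrow> mmap (A g) (Ident K x) = Ident K (omap (A g) x)"
  using functor_A[OF assms] by (simp_all add: cat_functor_def cat_functor_axioms_def)

lemma act_one: "x \<in> Obj K \<Longrightarrow> omap (A \<one>\<^bsub>G\<^esub>) x = x"
  using acts by (simp add: acts_on_def is_diagram_def group_cat_def func_eq_def func_id_def)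

lemma act_mult:
  "\<lbrakk>g \<in> carrier G; h \<in> carrier G; x \<in> Obj K\<rbrakk>
    \<Longrightarrow> omap (A (g \<otimes>\<^bsub>G\<^esub> h)) x = omap (A g) (omap (A h) x)"
  using acts by (simp add: acts_on_def is_diagram_def group_cat_def func_eq_def func_comp_def)

lemma act_inv:
  "\<lbrakk>g \<in> carrier G; x \<in> Obj K\<rbrakk> \<Longrightarrow> omap (A (inv\<^bsub>G\<^esub> g)) (omap (A g) x) = x"
  by (metis act_mult act_one inv_closed l_inv)

text \<open>The orbit of an object.\<close>

definition orb :: "'o \<Rightarrow> 'o set" where
  "orb x = {omap (A g) x | g. g \<in> carrier G}"

lemma orb_self: "x \<in> Obj K \<Longrightarrow> x \<in> orb x"
  unfolding orb_def using act_one one_closed by force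

lemma orb_act:
  assumes "x \<in> Obj K" "g \<in> carrier G"
  shows "orb (omap (A g) x) = orb x"
proof -
  have "orb (omap (A k) y) \<subseteq> orb y" if "y \<in> Obj K" "k \<in> carrier G" for y k
  proof
    fix z assume "z \<in> orb (omap (A k) y)"
    then obtain h where "h \<in> carrier G" "z = omap (A h) (omap (A k) y)"
      unfolding orb_def by blast
    then have "z = omap (A (h \<otimes>\<^bsub>G\<^esub> k)) y" "h \<otimes>\<^bsub>G\<^esub> k \<in> carrier G"
      using that by (simp_all add: act_mult)
    then show "z \<in> orb y" unfolding orb_def by blast
  qed
  from this[OF assms] this[of "omap (A g) x" "inv\<^bsub>G\<^esub> g"] show ?thesis
    using assms by (simp add: act_inv act_closed subset_antisym)
qed

lemma orb_eqD:
  assumes "x \<in> Obj K" "orb x = orb y"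
  obtains g where "g \<in> carrier G" "x = omap (A g) y"
proof -
  have "x \<in> orb y" using orb_self[OF assms(1)] assms(2) by simp
  then show ?thesis using that unfolding orb_def by blast
qed


section \<open>The category of orbits\<close>

text \<open>The congruence that the action generates on the morphisms of \<open>K\<close>.  Closure under
  composition is demanded only when both composites exist in \<open>K\<close>.\<close>

inductive cong :: "'m \<Rightarrow> 'm \<Rightarrow> bool" (infix "\<approx>" 50) where
  cong_refl: "f \<in> Mor K \<Longrightarrow> f \<approx> f"
| cong_act: "\<lbrakk>f \<in> Mor K; g \<in> carrier G\<rbrakk> \<Longrightarrow> f \<approx> mmap (A g) f"
| cong_sym: "f \<approx> f' \<Longrightarrow> f' \<approx> f"
| cong_trans: "\<lbrakk>f \<approx> f'; f' \<approx> f''\<rbrakk> \<Longrightarrow> f \<approx> f''"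
| cong_comp: "\<lbrakk>f \<approx> f'; e \<approx> e'; Dom K e = Cod K f; Dom K e' = Cod K f'\<rbrakk>
    \<Longrightarrow> Comp K e f \<approx> Comp K e' f'"

lemma cong_ends:
  "f \<approx> f' \<Longrightarrow> f \<in> Mor K \<and> f' \<in> Mor K \<and> orb (Dom K f) = orb (Dom K f') \<and>
    orb (Cod K f) = orb (Cod K f')"
proof (induction rule: cong.induct)
  case (cong_comp f f' e e')
  then show ?case by (simp add: Comp_closed Dom_Comp Cod_Comp)
qed (auto simp: act_closed orb_act Dom_closed Cod_closed)

text \<open>The class of a morphism under the congruence, each member \<open>f'\<close> being recorded as the
  one-step path \<open>[f']\<close>: quotient morphisms are classes of paths, and paths of length one
  suffice here.\<close>

definition mcls :: "'m \<Rightarrow> 'm list set" where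
  "mcls f = {[f'] | f'. f \<approx> f'}"

lemma mcls_mem: "[f'] \<in> mcls f \<longleftrightarrow> f \<approx> f'"
  by (simp add: mcls_def)

lemma mcls_eqI: "f \<approx> f' \<Longrightarrow> mcls f = mcls f'"
  unfolding mcls_def by (blast intro: cong_sym cong_trans)

text \<open>The structure maps are given by arbitrary representatives.  For composition the
  representatives have to be composable in \<open>K\<close>.\<close>

definition quot_cat :: "('o set, 'm list set) cat" where
  "quot_cat =
     \<lparr>Obj = orb ` Obj K, Mor = mcls ` Mor K,
      Dom = (\<lambda>m. orb (Dom K (SOME f. [f] \<in> m))),
      Cod = (\<lambda>m. orb (Cod K (SOME f. [f] \<in> m))),
      Ident = (\<lambda>X. mcls (Ident K (SOME x. x \<in> X))),
      Comp = (\<lambda>n m. mcls (SOME c. \<exists>f e. [f] \<in> m \<and> [e] \<in> n \<and> Dom K e = Cod K f \<and>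
        c = Comp K e f))\<rparr>"

text \<open>The projection from \<open>K\<close> to the category of orbits.\<close>

definition quot_proj :: "('o, 'm, 'o set, 'm list set) func" where
  "quot_proj = \<lparr>omap = orb, mmap = mcls\<rparr>"

lemma Obj_quot: "Obj quot_cat = orb ` Obj K"
  by (simp add: quot_cat_def)

lemma Mor_quot: "Mor quot_cat = mcls ` Mor K"
  by (simp add: quot_cat_def)

lemma some_mcls: "f \<in> Mor K \<Longrightarrow> f \<approx> (SOME f'. [f'] \<in> mcls f)"
  unfolding mcls_mem by (rule someI) (rule cong_refl)

lemma some_orb:
  assumes "x \<in> Obj K"
  obtains g where "g \<in> carrier G" "(SOME y. y \<in> orb x) = omap (A g) x"
proof -
  have "(SOME y. y \<in> orb x) \<in> orb x"
    by (rule someI) (rule orb_self[OF assms])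
  then show ?thesis
    using that orb_def[of x] by blast
qed

lemma Dom_quot: "f \<in> Mor K \<Longrightarrow> Dom quot_cat (mcls f) = orb (Dom K f)"
  using cong_ends[OF some_mcls] by (simp add: quot_cat_def)

lemma Cod_quot: "f \<in> Mor K \<Longrightarrow> Cod quot_cat (mcls f) = orb (Cod K f)"
  using cong_ends[OF some_mcls] by (simp add: quot_cat_def)

lemma Ident_quot:
  assumes "x \<in> Obj K"
  shows "Ident quot_cat (orb x) = mcls (Ident K x)"
proof -
  obtain g where "g \<in> carrier G" "(SOME y. y \<in> orb x) = omap (A g) x"
    by (rule some_orb[OF assms])
  then have "Ident quot_cat (orb x) = mcls (mmap (A g) (Ident K x))"
    using assms by (simp add: quot_cat_def act_closed)
  also have "\<dots> = mcls (Ident K x)"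
    using mcls_eqI[OF cong_act] \<open>g \<in> carrier G\<close> assms Ident_closed by simp
  finally show ?thesis .
qed

lemma Comp_quot:
  assumes "f \<in> Mor K" "e \<in> Mor K" "Dom K e = Cod K f"
  shows "Comp quot_cat (mcls e) (mcls f) = mcls (Comp K e f)"
proof -
  let ?P = "\<lambda>c. \<exists>f' e'. [f'] \<in> mcls f \<and> [e'] \<in> mcls e \<and> Dom K e' = Cod K f' \<and>
    c = Comp K e' f'"
  have "?P (Comp K e f)"
    using assms cong_refl unfolding mcls_mem by blast
  then have "?P (SOME c. ?P c)" by (rule someI)
  then obtain f' e' where "f \<approx> f'" "e \<approx> e'" "Dom K e' = Cod K f'"
    "(SOME c. ?P c) = Comp K e' f'"
    unfolding mcls_mem by blast
  then have "Comp K e f \<approx> (SOME c. ?P c)"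
    using cong_comp[of f f' e e'] assms(3) by simp
  then show ?thesis by (simp add: quot_cat_def mcls_eqI)
qed

text \<open>A translate of \<open>e\<close> composes with \<open>f\<close>; this is where invertibility of the elements of \<open>G\<close>
  is used.\<close>

lemma composable_lift:
  assumes "f \<in> Mor K" "e \<in> Mor K" "Dom quot_cat (mcls e) = Cod quot_cat (mcls f)"
  obtains e' where "e' \<in> Mor K" "mcls e' = mcls e" "Dom K e' = Cod K f"
proof -
  have "orb (Cod K f) = orb (Dom K e)"
    using assms by (simp add: Dom_quot Cod_quot)
  then obtain g where "g \<in> carrier G" "Cod K f = omap (A g) (Dom K e)"
    using orb_eqD[OF Cod_closed[OF assms(1)]] by blast
  then show ?thesis
    using that[of "mmap (A g) e"] assms(2) cong_act mcls_eqI act_closed by metis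
qed

lemma composable_reps:
  assumes "m \<in> Mor quot_cat" "n \<in> Mor quot_cat" "Dom quot_cat n = Cod quot_cat m"
  obtains f e where "f \<in> Mor K" "m = mcls f" "e \<in> Mor K" "n = mcls e" "Dom K e = Cod K f"
proof -
  obtain f e0 where "f \<in> Mor K" "m = mcls f" "e0 \<in> Mor K" "n = mcls e0"
    using assms(1,2) unfolding Mor_quot by blast
  moreover from this obtain e where "e \<in> Mor K" "mcls e = mcls e0" "Dom K e = Cod K f"
    using composable_lift[of f e0] assms(3) by blast
  ultimately show ?thesis using that[of f e] by simp
qed

lemma category_quot: "category quot_cat"
proof
  fix m assume "m \<in> Mor quot_cat"
  then obtain f where f: "f \<in> Mor K" "m = mcls f"
    unfolding Mor_quot by blast
  then show "Dom quot_cat m \<in> Obj quot_cat" "Cod quot_cat m \<in> Obj quot_cat"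
    by (simp_all add: Dom_quot Cod_quot Obj_quot Dom_closed Cod_closed)
  show "Comp quot_cat m (Ident quot_cat (Dom quot_cat m)) = m"
    using f by (simp add: Dom_quot Ident_quot Comp_quot Dom_closed Ident_closed Cod_Ident
        Comp_Ident_right)
  show "Comp quot_cat (Ident quot_cat (Cod quot_cat m)) m = m"
    using f by (simp add: Cod_quot Ident_quot Comp_quot Cod_closed Ident_closed Dom_Ident
        Comp_Ident_left)
next
  fix X assume "X \<in> Obj quot_cat"
  then obtain x where "x \<in> Obj K" "X = orb x"
    unfolding Obj_quot by blast
  then show "Ident quot_cat X \<in> Mor quot_cat" "Dom quot_cat (Ident quot_cat X) = X"
    "Cod quot_cat (Ident quot_cat X) = X"
    by (simp_all add: Ident_quot Mor_quot Dom_quot Cod_quot Ident_closed Dom_Ident Cod_Ident)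
next
  fix m n assume m: "m \<in> Mor quot_cat" and n: "n \<in> Mor quot_cat"
    and mn: "Dom quot_cat n = Cod quot_cat m"
  obtain f e where fe: "f \<in> Mor K" "m = mcls f" "e \<in> Mor K" "n = mcls e" "Dom K e = Cod K f"
    by (rule composable_reps[OF m n mn])
  show "Comp quot_cat n m \<in> Mor quot_cat"
    "Dom quot_cat (Comp quot_cat n m) = Dom quot_cat m"
    "Cod quot_cat (Comp quot_cat n m) = Cod quot_cat n"
    using fe by (simp_all add: Comp_quot Dom_quot Cod_quot Mor_quot Comp_closed Dom_Comp Cod_Comp)
  fix p assume p: "p \<in> Mor quot_cat" and np: "Dom quot_cat p = Cod quot_cat n"
  obtain d0 where "d0 \<in> Mor K" "p = mcls d0"
    using p unfolding Mor_quot by blast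
  then obtain d where d: "d \<in> Mor K" "mcls d = p" "Dom K d = Cod K e"
    using composable_lift[of e d0] fe np by blast
  show "Comp quot_cat p (Comp quot_cat n m) = Comp quot_cat (Comp quot_cat p n) m"
    using d(1,3) fe by (simp flip: d(2) add: Comp_quot Comp_closed Dom_Comp Cod_Comp Comp_assoc)
qed

lemma functor_quot_proj: "cat_functor K quot_cat quot_proj"
  unfolding cat_functor_def cat_functor_axioms_def
  by (auto simp: category_K category_quot quot_proj_def Obj_quot Mor_quot Dom_quot Cod_quot
      Ident_quot Comp_quot)


section \<open>The universal property\<close>

text \<open>A cocone on the diagram of the action is a functor that is invariant under the action.\<close>

lemma is_cocone_iff:
  "is_cocone (group_cat G) (\<lambda>_. K) A R S \<longleftrightarrow>
     cat_functor K R (S ()) \<and>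
     (\<forall>g\<in>carrier G. (\<forall>x\<in>Obj K. omap (S ()) (omap (A g) x) = omap (S ()) x) \<and>
       (\<forall>f\<in>Mor K. mmap (S ()) (mmap (A g) f) = mmap (S ()) f))"
  by (auto simp: is_cocone_def group_cat_def func_eq_def func_comp_def cat_functor_def)

lemma is_cocone_quot: "is_cocone (group_cat G) (\<lambda>_. K) A quot_cat (\<lambda>_. quot_proj)"
proof -
  have "mcls (mmap (A g) f) = mcls f" if "g \<in> carrier G" "f \<in> Mor K" for g f
    using cong_act[OF that(2,1)] mcls_eqI by simp
  then show ?thesis
    unfolding is_cocone_iff using functor_quot_proj by (simp add: quot_proj_def orb_act)
qed

lemma cong_invariant:
  assumes S: "cat_functor K R S"
    and inv: "\<And>g f. \<lbrakk>g \<in> carrier G; f \<in> Mor K\<rbrakk> \<Longrightarrow> mmap S (mmap (A g) f) = mmap S f"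
  shows "f \<approx> f' \<Longrightarrow> mmap S f = mmap S f'"
proof (induction rule: cong.induct)
  case (cong_comp f f' e e')
  interpret S: cat_functor K R S by (rule S)
  show ?case
    using cong_comp cong_ends S.mmap_Comp by metis
qed (auto simp: inv)

lemma quot_factorization:
  assumes S: "cat_functor K R S"
    and invo: "\<And>g x. \<lbrakk>g \<in> carrier G; x \<in> Obj K\<rbrakk> \<Longrightarrow> omap S (omap (A g) x) = omap S x"
    and invm: "\<And>g f. \<lbrakk>g \<in> carrier G; f \<in> Mor K\<rbrakk> \<Longrightarrow> mmap S (mmap (A g) f) = mmap S f"
  obtains U where "cat_functor quot_cat R U"
    "\<And>x. x \<in> Obj K \<Longrightarrow> omap U (orb x) = omap S x"
    "\<And>f. f \<in> Mor K \<Longrightarrow> mmap U (mcls f) = mmap S f"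
proof -
  interpret S: cat_functor K R S by (rule S)
  define U where "U = \<lparr>omap = (\<lambda>X. omap S (SOME x. x \<in> X)),
    mmap = (\<lambda>m. mmap S (SOME f. [f] \<in> m))\<rparr>"
  have Uo: "omap U (orb x) = omap S x" if x: "x \<in> Obj K" for x
  proof -
    obtain g where "g \<in> carrier G" "(SOME y. y \<in> orb x) = omap (A g) x"
      by (rule some_orb[OF x])
    then show ?thesis using invo x by (simp add: U_def)
  qed
  have Um: "mmap U (mcls f) = mmap S f" if "f \<in> Mor K" for f
    using cong_invariant[OF S invm some_mcls[OF that]] by (simp add: U_def)
  have "cat_functor quot_cat R U"
  proof (intro cat_functor.intro cat_functor_axioms.intro category_quot)
    show "category R" by (rule S.target.category_axioms)
  next
    fix m n assume m: "m \<in> Mor quot_cat" and n: "n \<in> Mor quot_cat"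
      and mn: "Dom quot_cat n = Cod quot_cat m"
    obtain f e where fe: "f \<in> Mor K" "m = mcls f" "e \<in> Mor K" "n = mcls e"
      "Dom K e = Cod K f"
      by (rule composable_reps[OF m n mn])
    show "mmap U (Comp quot_cat n m) = Comp R (mmap U n) (mmap U m)"
      using fe by (simp add: Comp_quot Um Comp_closed S.mmap_Comp)
  qed (auto simp: Obj_quot Mor_quot Dom_quot Cod_quot Ident_quot Uo Um Dom_closed Cod_closed
      Ident_closed S.omap_closed S.mmap_closed S.Dom_mmap S.Cod_mmap S.mmap_Ident)
  then show ?thesis using that Uo Um by blast
qed

lemma is_quotient_quot_cat:
  "is_quotient TYPE('p) TYPE('q) G K A quot_cat quot_proj"
  unfolding is_quotient_def is_colimit_def
proof (intro conjI allI impI is_cocone_quot)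
  fix R :: "('p, 'q) cat" and S
  assume "is_cocone (group_cat G) (\<lambda>_. K) A R S"
  then have S: "cat_functor K R (S ())"
    and inv: "\<And>g x. \<lbrakk>g \<in> carrier G; x \<in> Obj K\<rbrakk> \<Longrightarrow> omap (S ()) (omap (A g) x) = omap (S ()) x"
      "\<And>g f. \<lbrakk>g \<in> carrier G; f \<in> Mor K\<rbrakk> \<Longrightarrow> mmap (S ()) (mmap (A g) f) = mmap (S ()) f"
    by (simp_all add: is_cocone_iff)
  obtain U where "cat_functor quot_cat R U"
    "\<And>x. x \<in> Obj K \<Longrightarrow> omap U (orb x) = omap (S ()) x"
    "\<And>f. f \<in> Mor K \<Longrightarrow> mmap U (mcls f) = mmap (S ()) f"
    using quot_factorization[OF S inv] by blast
  then show "\<exists>U. cat_functor quot_cat R U \<and>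
      (\<forall>i\<in>Obj (group_cat G). func_eq K (func_comp U quot_proj) (S i)) \<and>
      (\<forall>U'. cat_functor quot_cat R U' \<and>
        (\<forall>i\<in>Obj (group_cat G). func_eq K (func_comp U' quot_proj) (S i))
        \<longrightarrow> func_eq quot_cat U' U)"
    by (intro exI[of _ U])
      (auto simp: group_cat_def func_eq_def func_comp_def quot_proj_def Obj_quot Mor_quot)
qed

end


section \<open>Loopfreeness\<close>

lemma (in cat_action) loopfree_quot_cat:
  assumes lf: "loopfree K" and hor: "horizontal_action G K A"
  shows "loopfree quot_cat"
proof -
  have fixed: "omap (A h) x = x"
    if "h \<in> carrier G" "f \<in> Mor K" "Dom K f = x" "Cod K f = omap (A h) x" for h f x
    using hor that Dom_closed[OF that(2)]
    unfolding horizontal_action_def horizontal_functor_def Hom_def by blast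
  have antisym: "Dom K f = Cod K f"
    if "f \<in> Mor K" "e \<in> Mor K" "Dom K e = Cod K f" "Cod K e = Dom K f" for f e
    using lf that Dom_closed Cod_closed unfolding loopfree_def Hom_def by blast
  have endo: "f = Ident K (Dom K f)" if "f \<in> Mor K" "Cod K f = Dom K f" for f
    using lf that Dom_closed unfolding loopfree_def Hom_def by blast
  have "X = Y" if m: "m \<in> Hom quot_cat X Y" and n: "n \<in> Hom quot_cat Y X" for X Y m n
  proof -
    obtain f e where f: "f \<in> Mor K" "m = mcls f" and e: "e \<in> Mor K" "n = mcls e"
      and fe: "Dom K e = Cod K f"
      using composable_reps[of m n] m n unfolding Hom_def by blast
    have XY: "X = orb (Dom K f)" "Y = orb (Cod K f)"
      using m f by (simp_all add: Hom_def Dom_quot Cod_quot)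
    have "orb (Cod K e) = orb (Dom K f)"
      using n e XY by (simp add: Hom_def Cod_quot)
    then obtain k where k: "k \<in> carrier G" "Cod K e = omap (A k) (Dom K f)"
      using orb_eqD[OF Cod_closed[OF e(1)]] by blast
    \<comment> \<open>The composite of \<open>f\<close> and \<open>e\<close> runs from \<open>Dom K f\<close> to its translate by \<open>k\<close>.\<close>
    have "omap (A k) (Dom K f) = Dom K f"
      using fixed[OF k(1), of "Comp K e f"] f e fe k by (simp add: Comp_closed Dom_Comp Cod_Comp)
    then show ?thesis using antisym[OF f(1) e(1)] fe k XY by simp
  qed
  moreover have "Hom quot_cat X X = {Ident quot_cat X}" if X: "X \<in> Obj quot_cat" for X
  proof -
    interpret quot: category quot_cat by (rule category_quot)
    have "m = Ident quot_cat X" if m: "m \<in> Hom quot_cat X X" for m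
    proof -
      obtain f where f: "f \<in> Mor K" "m = mcls f" "X = orb (Dom K f)" "X = orb (Cod K f)"
        using m by (auto simp: Hom_def Mor_quot Dom_quot Cod_quot)
      then obtain k where k: "k \<in> carrier G" "Cod K f = omap (A k) (Dom K f)"
        using orb_eqD[OF Cod_closed[OF f(1)]] by metis
      have "f = Ident K (Dom K f)"
        using endo[OF f(1)] fixed[OF k(1) f(1)] k by simp
      then show ?thesis using f Ident_quot Dom_closed by metis
    qed
    moreover have "Ident quot_cat X \<in> Hom quot_cat X X"
      using X by (simp add: Hom_def quot.Ident_closed quot.Dom_Ident quot.Cod_Ident)
    ultimately show ?thesis by blast
  qed
  ultimately show ?thesis
    unfolding loopfree_def using category_quot by blast
qed

lemma loopfree_retract:
  assumes lf: "loopfree C" and U: "cat_functor Q C U" and V: "cat_functor C Q V"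
    and VU: "func_eq Q (func_comp V U) func_id"
  shows "loopfree Q"
proof -
  interpret U: cat_functor Q C U by (rule U)
  interpret V: cat_functor C Q V by (rule V)
  have VUo: "omap V (omap U x) = x" if "x \<in> Obj Q" for x
    using VU that by (simp add: func_eq_def func_comp_def func_id_def)
  have VUm: "mmap V (mmap U f) = f" if "f \<in> Mor Q" for f
    using VU that by (simp add: func_eq_def func_comp_def func_id_def)
  have UHom: "mmap U f \<in> Hom C (omap U x) (omap U y)" if "f \<in> Hom Q x y" for f x y
    using that by (auto simp: Hom_def U.mmap_closed U.Dom_mmap U.Cod_mmap)
  have "x = y" if "x \<in> Obj Q" "y \<in> Obj Q" "f \<in> Hom Q x y" "e \<in> Hom Q y x" for x y f e
  proof -
    have "omap U x = omap U y"
      using lf UHom[OF that(3)] UHom[OF that(4)] U.omap_closed that(1,2)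
      unfolding loopfree_def by blast
    then show ?thesis using VUo that(1,2) by metis
  qed
  moreover have "Hom Q x x = {Ident Q x}" if x: "x \<in> Obj Q" for x
  proof -
    have "f = Ident Q x" if f: "f \<in> Hom Q x x" for f
    proof -
      have "mmap U f = Ident C (omap U x)"
        using lf UHom[OF f] U.omap_closed[OF x] unfolding loopfree_def by blast
      then show ?thesis
        using f VUm VUo[OF x] V.mmap_Ident U.omap_closed[OF x] by (simp add: Hom_def) metis
    qed
    moreover have "Ident Q x \<in> Hom Q x x"
      using x by (simp add: Hom_def U.source.Ident_closed U.source.Dom_Ident U.source.Cod_Ident)
    ultimately show ?thesis by blast
  qed
  ultimately show ?thesis
    unfolding loopfree_def using U.source.category_axioms by blast
qed

lemma cat_functor_comp:
  assumes "cat_functor C D F" "cat_functor D E F'"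
  shows "cat_functor C E (func_comp F' F)"
proof -
  interpret F: cat_functor C D F by fact
  interpret F': cat_functor D E F' by fact
  show ?thesis
    by unfold_locales (simp_all add: func_comp_def F.omap_closed F.mmap_closed F.Dom_mmap
        F.Cod_mmap F.mmap_Ident F.mmap_Comp F'.omap_closed F'.mmap_closed F'.Dom_mmap
        F'.Cod_mmap F'.mmap_Ident F'.mmap_Comp)
qed

lemma cat_functor_id: "category C \<Longrightarrow> cat_functor C C func_id"
  by (simp add: cat_functor_def cat_functor_axioms_def func_id_def category.Dom_closed)

text \<open>The usual uniqueness argument for colimits.  Universality of \<open>C\<close> gives \<open>V\<close>, and the two
  instances of universality of \<open>Q\<close> give \<open>U\<close> and \<open>V \<circ> U = id\<close>.\<close>

lemma quotient_retract:
  fixes C :: "('s, 't) cat" and Q :: "('u, 'v) cat"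
  assumes C: "is_quotient TYPE('u) TYPE('v) G K A C P'"
    and Q: "is_quotient TYPE('u) TYPE('v) G K A Q P" "is_quotient TYPE('s) TYPE('t) G K A Q P"
  obtains U V where "cat_functor Q C U" "cat_functor C Q V"
    "func_eq Q (func_comp V U) func_id"
proof -
  have obj: "Obj (group_cat G) = {()}" by (simp add: group_cat_def)
  have cC: "is_cocone (group_cat G) (\<lambda>_. K) A C (\<lambda>_. P')"
    and cQ: "is_cocone (group_cat G) (\<lambda>_. K) A Q (\<lambda>_. P)"
    using C Q by (simp_all add: is_quotient_def is_colimit_def)
  obtain U where U: "cat_functor Q C U" "func_eq K (func_comp U P) P'"
    using Q(2) cC unfolding is_quotient_def is_colimit_def obj by blast
  obtain V where V: "cat_functor C Q V" "func_eq K (func_comp V P') P"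
    using C cQ unfolding is_quotient_def is_colimit_def obj by blast
  obtain W where W: "\<And>U'. \<lbrakk>cat_functor Q Q U'; func_eq K (func_comp U' P) P\<rbrakk> \<Longrightarrow> func_eq Q U' W"
    using Q(1) cQ unfolding is_quotient_def is_colimit_def obj by blast
  have "func_eq K (func_comp (func_comp V U) P) P"
    using U(2) V(2) by (simp add: func_eq_def func_comp_def)
  then have "func_eq Q (func_comp V U) W"
    using W cat_functor_comp[OF U(1) V(1)] by blast
  moreover have "category Q" using cQ by (simp add: is_cocone_def)
  then have "func_eq Q func_id W"
    by (rule W[OF cat_functor_id]) (simp add: func_eq_def func_comp_def func_id_def)
  ultimately have "func_eq Q (func_comp V U) func_id"
    by (simp add: func_eq_def)
  then show ?thesis using that U(1) V(1) by blast
qed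

lemma loopfree_poset_cat:
  assumes "partial_order_on X r"
  shows "loopfree (poset_cat X r)"
proof -
  have refl: "(x, x) \<in> r" if "x \<in> X" for x
    using assms that by (auto simp: partial_order_on_def preorder_on_def refl_on_def)
  have trans: "trans r" and anti: "antisym r"
    using assms by (auto simp: partial_order_on_def preorder_on_def)
  have "category (poset_cat X r)"
    by unfold_locales (auto simp: poset_cat_def refl intro: transD[OF trans])
  then show ?thesis
    by (auto simp: loopfree_def Hom_def poset_cat_def refl dest: antisymD[OF anti])
qed

lemma horizontal_quotient:
  fixes K :: "('o, 'm) cat"
  assumes lf: "loopfree K" and hor: "horizontal_action G K A"
  shows "\<exists>(Q :: ('o set, 'm list set) cat) P.
      is_quotient TYPE('o set) TYPE('m list set) G K A Q P \<and>
      is_quotient TYPE('p) TYPE('q) G K A Q P"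
    and "\<lbrakk>is_quotient TYPE('u) TYPE('v) G K A Q P;
      is_quotient TYPE('o set) TYPE('m list set) G K A Q P\<rbrakk> \<Longrightarrow> loopfree (Q :: ('u, 'v) cat)"
proof -
  interpret cat_action G K A
    using hor by unfold_locales (simp add: horizontal_action_def)
  show "\<exists>(Q :: ('o set, 'm list set) cat) P.
      is_quotient TYPE('o set) TYPE('m list set) G K A Q P \<and>
      is_quotient TYPE('p) TYPE('q) G K A Q P"
    by (rule exI[of _ quot_cat], rule exI[of _ quot_proj], rule conjI;
        rule is_quotient_quot_cat)
  assume Q: "is_quotient TYPE('u) TYPE('v) G K A Q P"
    "is_quotient TYPE('o set) TYPE('m list set) G K A Q P"
  obtain U V where "cat_functor Q quot_cat U" "cat_functor quot_cat Q V"
    "func_eq Q (func_comp V U) func_id"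
    by (rule quotient_retract[OF is_quotient_quot_cat Q])
  then show "loopfree Q"
    by (rule loopfree_retract[OF loopfree_quot_cat[OF lf hor]])
qed

(* In each of the two parts, the first conjunct says that the quotient exists: it is universal for
   categories on arbitrary types 'p, 'q, and also for categories on its own types, so it is
   determined up to isomorphism independently of 'p and 'q.  The second conjunct says that every
   quotient is loopfree; it assumes the universal property only for two particular choices of the
   types of the test categories. *)

theorem proposition3p12:
  fixes G :: "('g, 'b) monoid_scheme"
    and K :: "('o, 'm) cat" and A :: "'g \<Rightarrow> ('o, 'm, 'o, 'm) func"
    and X :: "'a set" and r :: "'a rel" and B :: "'g \<Rightarrow> ('a, 'a \<times> 'a, 'a, 'a \<times> 'a) func"
  shows "(loopfree K \<and> horizontal_action G K A \<longrightarrow>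
      (\<exists>(Q :: ('o set, 'm list set) cat) P.
          is_quotient TYPE('o set) TYPE('m list set) G K A Q P \<and>
          is_quotient TYPE('p) TYPE('q) G K A Q P) \<and>
      (\<forall>(Q :: ('u, 'v) cat) P.
          is_quotient TYPE('u) TYPE('v) G K A Q P \<and>
          is_quotient TYPE('o set) TYPE('m list set) G K A Q P \<longrightarrow> loopfree Q))
    \<and> (partial_order_on X r \<and> horizontal_action G (poset_cat X r) B \<longrightarrow>
      (\<exists>(Q :: ('a set, ('a \<times> 'a) list set) cat) P.
          is_quotient TYPE('a set) TYPE(('a \<times> 'a) list set) G (poset_cat X r) B Q P \<and>
          is_quotient TYPE('p) TYPE('q) G (poset_cat X r) B Q P) \<and>
      (\<forall>(Q :: ('u, 'v) cat) P.
          is_quotient TYPE('u) TYPE('v) G (poset_cat X r) B Q P \<and>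
          is_quotient TYPE('a set) TYPE(('a \<times> 'a) list set) G (poset_cat X r) B Q P
          \<longrightarrow> loopfree Q))"
proof (intro conjI impI allI; (elim conjE)?)
  show "\<exists>(Q :: ('o set, 'm list set) cat) P.
      is_quotient TYPE('o set) TYPE('m list set) G K A Q P \<and>
      is_quotient TYPE('p) TYPE('q) G K A Q P"
    if "loopfree K" "horizontal_action G K A"
    using that by (rule horizontal_quotient)
  show "loopfree Q"
    if "loopfree K" "horizontal_action G K A" "is_quotient TYPE('u) TYPE('v) G K A Q P"
      "is_quotient TYPE('o set) TYPE('m list set) G K A Q P" for Q :: "('u, 'v) cat" and P
    using that by (rule horizontal_quotient)
  show "\<exists>(Q :: ('a set, ('a \<times> 'a) list set) cat) P.
      is_quotient TYPE('a set) TYPE(('a \<times> 'a) list set) G (poset_cat X r) B Q P \<and>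
      is_quotient TYPE('p) TYPE('q) G (poset_cat X r) B Q P"
    if "partial_order_on X r" "horizontal_action G (poset_cat X r) B"
    using loopfree_poset_cat[OF that(1)] that(2) by (rule horizontal_quotient)
  show "loopfree Q"
    if "partial_order_on X r" "horizontal_action G (poset_cat X r) B"
      "is_quotient TYPE('u) TYPE('v) G (poset_cat X r) B Q P"
      "is_quotient TYPE('a set) TYPE(('a \<times> 'a) list set) G (poset_cat X r) B Q P"
    for Q :: "('u, 'v) cat" and P
    using loopfree_poset_cat[OF that(1)] that(2-4) by (rule horizontal_quotient)
qed

end
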